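(* For every fixed $\beta\in(0,1]$ and $\delta\in[0,1]$, $$\mathcal C_\beta(\delta)=\delta .$$
   Context: Instance: firms $F=\{1,\dots,m\}$, workers $W=\{1,\dots,n\}$ ($n$ arbitrary), values $A=(a_{ij})$ with $a_{ij}\ge 0$, additive: $V_i(T)=\sum_{j\in T}a_{ij}$. A complete matching $X=(X_1,\dots,X_m)$ is a partition of $W$ (parts may be empty). $M_j=\max_i a_{ij}$. If some $a_{ij}>0$, $\delta(A)=\min_{a_{ij}>0}a_{ij}/M_j$; for the all-zero market $\delta(A)=1$. $X$ is $\beta$-EF1 if for every pair of firms $i,k$ with $X_k\neq\varnothing$ there is $g\in X_k$ with $V_i(X_i)\ge\beta V_i(X_k\setminus\{g\})$. Core: profits $x_i\ge 0$ and wages $y_j\ge 0$ satisfy local financing if $x_i+\sum_{j\in X_i}y_j=V_i(X_i)$ for all $i$. $(X,x,y)$ is in the $\alpha$-core if $\sum_{i\in I}x_i+\sum_{j\in T}y_j\ge\alpha\sum_{j\in T}\max_{i\in I}a_{ij}$ for all nonempty $I\subseteq F$ and all $T\subseteq W$. $\alpha(X)$ is the largest $\alpha$ (supremum in $[0,+\infty]$) for which some nonnegative $x,y$ satisfying local financing make $(X,x,y)$ an element of the $\alpha$-core. Scale-free frontier: $\mathcal C_\beta(\delta)=\inf_{m\ge 2}\ \inf_{A:\,\delta(A)\ge\delta}\ \max_{X:\,\beta\text{-EF1}}\alpha(X)$, where $A$ ranges over all instances with $m$ firms and $\delta(A)\ge\delta$, and $X$ over all $\beta$-EF1 complete matchings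 of the instance. *)

theory Defs
  imports "HOL-Analysis.Analysis"
begin

text \<open>
  A market with firms \<open>{1..m}\<close> and workers \<open>{1..n}\<close> is given by \<open>m\<close>, \<open>n\<close> and the values
  \<open>a i j\<close> of worker \<open>j\<close> to firm \<open>i\<close>. Values of \<open>a\<close> outside these index ranges are irrelevant.
\<close>

definition market :: "nat \<Rightarrow> nat \<Rightarrow> (nat \<Rightarrow> nat \<Rightarrow> real) \<Rightarrow> bool" where
  "market m n a \<longleftrightarrow> (\<forall>i\<in>{1..m}. \<forall>j\<in>{1..n}. 0 \<le> a i j)"

definition firm_value :: "(nat \<Rightarrow> nat \<Rightarrow> real) \<Rightarrow> nat \<Rightarrow> nat set \<Rightarrow> real" where
  "firm_value a i T = (\<Sum>j\<in>T. a i j)"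

definition max_value :: "(nat \<Rightarrow> nat \<Rightarrow> real) \<Rightarrow> nat set \<Rightarrow> nat \<Rightarrow> real" where
  "max_value a I j = Max ((\<lambda>i. a i j) ` I)"

definition market_delta :: "nat \<Rightarrow> nat \<Rightarrow> (nat \<Rightarrow> nat \<Rightarrow> real) \<Rightarrow> real" where
  "market_delta m n a =
    (if \<exists>i\<in>{1..m}. \<exists>j\<in>{1..n}. a i j > 0
     then Min {a i j / max_value a {1..m} j | i j. i \<in> {1..m} \<and> j \<in> {1..n} \<and> a i j > 0}
     else 1)"

text \<open>
  Matchings are extensional functions, so that a market has only finitely many of them and the
  maximum in the definition of the frontier is over a finite set.
\<close>

definition complete_matching :: "nat \<Rightarrow> nat \<Rightarrow> (nat \<Rightarrow> nat set) \<Rightarrow> bool" where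
  "complete_matching m n X \<longleftrightarrow>
    X \<in> extensional {1..m} \<and> disjoint_family_on X {1..m} \<and> (\<Union>i\<in>{1..m}. X i) = {1..n}"

definition EF1 :: "nat \<Rightarrow> (nat \<Rightarrow> nat \<Rightarrow> real) \<Rightarrow> real \<Rightarrow> (nat \<Rightarrow> nat set) \<Rightarrow> bool" where
  "EF1 m a \<beta> X \<longleftrightarrow>
    (\<forall>i\<in>{1..m}. \<forall>k\<in>{1..m}. X k \<noteq> {} \<longrightarrow>
      (\<exists>g\<in>X k. firm_value a i (X i) \<ge> \<beta> * firm_value a i (X k - {g})))"

definition local_financing ::
  "nat \<Rightarrow> (nat \<Rightarrow> nat \<Rightarrow> real) \<Rightarrow> (nat \<Rightarrow> nat set) \<Rightarrow> (nat \<Rightarrow> real) \<Rightarrow> (nat \<Rightarrow> real) \<Rightarrow> bool" where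
  "local_financing m a X x y \<longleftrightarrow>
    (\<forall>i\<in>{1..m}. x i + (\<Sum>j\<in>X i. y j) = firm_value a i (X i))"

definition in_core ::
  "nat \<Rightarrow> nat \<Rightarrow> (nat \<Rightarrow> nat \<Rightarrow> real) \<Rightarrow> real \<Rightarrow> (nat \<Rightarrow> nat set) \<Rightarrow> (nat \<Rightarrow> real) \<Rightarrow> (nat \<Rightarrow> real) \<Rightarrow> bool"
  where
  "in_core m n a \<alpha> X x y \<longleftrightarrow>
    (\<forall>i\<in>{1..m}. 0 \<le> x i) \<and> (\<forall>j\<in>{1..n}. 0 \<le> y j) \<and> local_financing m a X x y \<and>
    (\<forall>I T. I \<subseteq> {1..m} \<and> I \<noteq> {} \<and> T \<subseteq> {1..n} \<longrightarrow>
      (\<Sum>i\<in>I. x i) + (\<Sum>j\<in>T. y j) \<ge> \<alpha> * (\<Sum>j\<in>T. max_value a I j))"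

definition core_ratio :: "nat \<Rightarrow> nat \<Rightarrow> (nat \<Rightarrow> nat \<Rightarrow> real) \<Rightarrow> (nat \<Rightarrow> nat set) \<Rightarrow> ennreal" where
  "core_ratio m n a X = Sup {ennreal \<alpha> | \<alpha>. 0 \<le> \<alpha> \<and> (\<exists>x y. in_core m n a \<alpha> X x y)}"

text \<open>
  For \<open>\<beta> \<le> 1\<close> every market has a \<open>\<beta>\<close>-EF1 complete matching, so the maximum is over a nonempty set.
\<close>

definition frontier_value :: "real \<Rightarrow> real \<Rightarrow> ennreal" where
  "frontier_value \<beta> \<delta> =
    (INF m\<in>{2..}. INF (n, a)\<in>{(n, a). market m n a \<and> market_delta m n a \<ge> \<delta>}.
      Max (core_ratio m n a ` {X. complete_matching m n X \<and> EF1 m a \<beta> X}))"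

end

theory Submission
  imports Defs
begin

text \<open>
  Lower bound: choose a matching that maximizes first the number of firms with positive value and
  then the product of the positive values. As for maximum Nash welfare, exchanging one worker
  shows that it is EF1, and that a worker of positive value to some firm is matched to
  such a firm. With zero profits and each wage equal to the value produced, every worker then
  receives at least the fraction \<open>\<delta>\<close> of the maximal value.

  Upper bound: one firm values each of \<open>N\<close> workers at \<open>1\<close> and \<open>N\<close> further firms value them at
  \<open>\<eta>\<close>. By \<open>\<beta>\<close>-EF1 the first firm obtains only a bounded number of workers, so the welfare ratio,
  and with it the core ratio, tends to \<open>\<eta>\<close>. The case \<open>\<delta> = 0\<close> needs \<open>\<eta> \<rightarrow> 0\<close>, because
  \<open>\<eta> = 0\<close> would make the other firms free of envy.
\<close>

section \<open>Markets and matchings\<close>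

lemma finite_complete_matchings: "finite {X. complete_matching m n X}"
proof (rule finite_subset)
  show "{X. complete_matching m n X} \<subseteq> PiE {1..m} (\<lambda>_. Pow {1..n})"
    unfolding complete_matching_def PiE_def Pi_def by blast
qed (intro finite_PiE; simp)

lemma complete_matching_exists:
  assumes "1 \<le> m"
  shows "\<exists>X. complete_matching m n X"
proof
  show "complete_matching m n (\<lambda>i\<in>{1..m}. if i = 1 then {1..n} else {})"
    using assms
    by (auto simp: complete_matching_def disjoint_family_on_def extensional_def restrict_def
        split: if_splits)
qed

lemma complete_matching_subset:
  assumes "complete_matching m n X" "i \<in> {1..m}"
  shows "X i \<subseteq> {1..n}"
  using assms unfolding complete_matching_def by blast

lemma complete_matching_finite:
  assumes "complete_matching m n X" "i \<in> {1..m}"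
  shows "finite (X i)"
  using complete_matching_subset[OF assms] finite_subset by blast

text \<open>This single-worker transfer is the only exchange against which optimality is tested
  later.\<close>

lemma complete_matching_move:
  assumes "complete_matching m n X" "i \<in> {1..m}" "k \<in> {1..m}" "i \<noteq> k" "g \<in> X k"
  shows "complete_matching m n (X(k := X k - {g}, i := insert g (X i)))"
    (is "complete_matching m n ?Y")
proof -
  have ext: "X \<in> extensional {1..m}" and un: "(\<Union>i\<in>{1..m}. X i) = {1..n}"
    and dis: "\<And>p q. p \<in> {1..m} \<Longrightarrow> q \<in> {1..m} \<Longrightarrow> p \<noteq> q \<Longrightarrow> X p \<inter> X q = {}"
    using assms(1) unfolding complete_matching_def disjoint_family_on_def by auto
  have "?Y \<in> extensional {1..m}"
    using ext assms(2,3) by (auto simp: extensional_def)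
  moreover have "disjoint_family_on ?Y {1..m}"
    unfolding disjoint_family_on_def
  proof (intro ballI impI)
    fix p q assume pq: "p \<in> {1..m}" "q \<in> {1..m}" "p \<noteq> q"
    have "g \<notin> X r" if "r \<in> {1..m}" "r \<noteq> k" for r
      using dis[OF that(1) assms(3) that(2)] assms(5) by blast
    then show "?Y p \<inter> ?Y q = {}"
      using dis[OF pq] pq assms(4) dis[of k q] dis[of p k] dis[of i k] dis[of i q] dis[of p i]
        assms(2,3)
      by (auto simp: fun_upd_def split: if_splits)
  qed
  moreover have "(\<Union>p\<in>{1..m}. ?Y p) = (\<Union>p\<in>{1..m}. X p)"
  proof
    show "(\<Union>p\<in>{1..m}. ?Y p) \<subseteq> (\<Union>p\<in>{1..m}. X p)"
      using assms(2-5) by (auto split: if_splits)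
    show "(\<Union>p\<in>{1..m}. X p) \<subseteq> (\<Union>p\<in>{1..m}. ?Y p)"
    proof
      fix j assume "j \<in> (\<Union>p\<in>{1..m}. X p)"
      then obtain p where p: "p \<in> {1..m}" "j \<in> X p" by blast
      \<comment> \<open>Only \<open>g\<close> can leave its old bundle, and it then lies in the
        bundle of \<open>i\<close>.\<close>
      have "j \<in> ?Y i \<or> j \<in> ?Y p" using p assms(4) by auto
      then show "j \<in> (\<Union>p\<in>{1..m}. ?Y p)" using p(1) assms(2) by blast
    qed
  qed
  ultimately show ?thesis
    unfolding complete_matching_def using un by simp
qed

lemma sum_complete_matching:
  assumes "complete_matching m n X"
  shows "(\<Sum>i\<in>{1..m}. \<Sum>j\<in>X i. f j) = (\<Sum>j\<in>{1..n}. f j)"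
proof -
  have "(\<Sum>j\<in>(\<Union>i\<in>{1..m}. X i). f j) = (\<Sum>i\<in>{1..m}. \<Sum>j\<in>X i. f j)"
    using assms complete_matching_finite[OF assms]
    by (intro sum.UNION_disjoint) (auto simp: complete_matching_def disjoint_family_on_def)
  then show ?thesis
    using assms by (simp add: complete_matching_def)
qed

lemma firm_value_nonneg:
  assumes "market m n a" "i \<in> {1..m}" "T \<subseteq> {1..n}"
  shows "0 \<le> firm_value a i T"
  using assms unfolding firm_value_def market_def by (intro sum_nonneg) auto

lemma firm_value_remove:
  assumes "finite T" "g \<in> T"
  shows "firm_value a i (T - {g}) = firm_value a i T - a i g"
  using assms by (simp add: firm_value_def sum_diff1)

lemma max_value_ge:
  assumes "finite I" "i \<in> I"
  shows "a i j \<le> max_value a I j"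
  using assms by (auto simp: max_value_def)

lemma max_value_mono:
  assumes "finite J" "I \<subseteq> J" "I \<noteq> {}"
  shows "max_value a I j \<le> max_value a J j"
  unfolding max_value_def using assms by (intro Max_mono) auto

lemma finite_market_ratios:
  fixes a :: "nat \<Rightarrow> nat \<Rightarrow> real"
  shows "finite {a i j / max_value a {1..m} j | i j. i \<in> {1..m} \<and> j \<in> {1..n} \<and> a i j > 0}"
  by (rule finite_subset[of _ "(\<lambda>(i,j). a i j / max_value a {1..m} j) ` ({1..m} \<times> {1..n})"]) auto

lemma market_delta_max_value_le:
  assumes "i \<in> {1..m}" "j \<in> {1..n}" "0 < a i j"
  shows "market_delta m n a * max_value a {1..m} j \<le> a i j"
proof -
  have "market_delta m n a \<le> a i j / max_value a {1..m} j"
    unfolding market_delta_def using assms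
    by (subst if_P, blast, intro Min_le finite_market_ratios) blast
  moreover have "0 < max_value a {1..m} j"
    using max_value_ge[of "{1..m}" i a j] assms by simp
  ultimately show ?thesis
    by (simp add: pos_le_divide_eq)
qed

section \<open>Nash-optimal matchings\<close>

definition positive_firms :: "nat \<Rightarrow> (nat \<Rightarrow> nat \<Rightarrow> real) \<Rightarrow> (nat \<Rightarrow> nat set) \<Rightarrow> nat set" where
  "positive_firms m a X = {i \<in> {1..m}. 0 < firm_value a i (X i)}"

text \<open>Nash welfare restricted to firms of positive value. The product over all firms would
  vanish for every matching when, for example, there are fewer workers than firms, and maximizing it
  would then say nothing.\<close>

definition nash_product :: "nat \<Rightarrow> (nat \<Rightarrow> nat \<Rightarrow> real) \<Rightarrow> (nat \<Rightarrow> nat set) \<Rightarrow> real" where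
  "nash_product m a X = (\<Prod>i\<in>positive_firms m a X. firm_value a i (X i))"

definition nash_optimal :: "nat \<Rightarrow> nat \<Rightarrow> (nat \<Rightarrow> nat \<Rightarrow> real) \<Rightarrow> (nat \<Rightarrow> nat set) \<Rightarrow> bool" where
  "nash_optimal m n a X \<longleftrightarrow> complete_matching m n X \<and>
    (\<forall>Y. complete_matching m n Y \<longrightarrow>
      card (positive_firms m a Y) \<le> card (positive_firms m a X) \<and>
      (card (positive_firms m a Y) = card (positive_firms m a X) \<longrightarrow>
        nash_product m a Y \<le> nash_product m a X))"

lemma finite_positive_firms [simp]: "finite (positive_firms m a X)"
  by (simp add: positive_firms_def)

lemma finite_has_maximizer:
  fixes f :: "'a \<Rightarrow> 'b::linorder"
  assumes "finite S" "S \<noteq> {}"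
  shows "\<exists>x\<in>S. \<forall>y\<in>S. f y \<le> f x"
proof -
  have "Max (f ` S) \<in> f ` S" using assms by simp
  then obtain x where "x \<in> S" "f x = Max (f ` S)" by force
  then show ?thesis using assms(1) by force
qed

lemma nash_optimal_exists:
  assumes "1 \<le> m"
  shows "\<exists>X. nash_optimal m n a X"
proof -
  let ?M = "{X. complete_matching m n X}"
  let ?c = "\<lambda>X. card (positive_firms m a X)"
  have fin: "finite ?M" by (rule finite_complete_matchings)
  obtain X0 where X0: "X0 \<in> ?M" "\<And>Y. Y \<in> ?M \<Longrightarrow> ?c Y \<le> ?c X0"
    using finite_has_maximizer[OF fin, of ?c] complete_matching_exists[OF assms, of n] by blast
  let ?N = "{X \<in> ?M. ?c X = ?c X0}"
  have "finite ?N" "?N \<noteq> {}" using fin X0(1) by auto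
  then obtain X where X: "X \<in> ?N" "\<And>Y. Y \<in> ?N \<Longrightarrow> nash_product m a Y \<le> nash_product m a X"
    using finite_has_maximizer[of ?N "nash_product m a"] by blast
  have "nash_optimal m n a X"
    unfolding nash_optimal_def using X X0 by auto
  then show ?thesis by blast
qed

text \<open>Compare \<open>X\<close> with the matching that moves \<open>g\<close> from
  \<open>k\<close> to \<open>i\<close>. By \<open>rest\<close>, firm \<open>k\<close> keeps positive
  value if it had any, so the move can only add \<open>i\<close> to the positive firms. Maximal
  cardinality forces \<open>i\<close> to be positive already; then the products are comparable, and
  the common factors cancel.\<close>

lemma nash_optimal_move:
  assumes mk: "market m n a" and opt: "nash_optimal m n a X"
    and i: "i \<in> {1..m}" and k: "k \<in> {1..m}" and ik: "i \<noteq> k" and g: "g \<in> X k" and pos: "0 < a i g"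
    and rest: "a k g = 0 \<or> a k g < firm_value a k (X k)"
  shows "i \<in> positive_firms m a X \<and> k \<in> positive_firms m a X \<and>
    (firm_value a k (X k) - a k g) * (firm_value a i (X i) + a i g)
      \<le> firm_value a k (X k) * firm_value a i (X i)"
proof -
  define Y where "Y = X(k := X k - {g}, i := insert g (X i))"
  let ?P = "positive_firms m a X"
  have cm: "complete_matching m n X" using opt by (simp add: nash_optimal_def)
  have cY: "complete_matching m n Y"
    unfolding Y_def using cm i k ik g by (rule complete_matching_move)
  have fin: "finite (X i)" "finite (X k)" using complete_matching_finite[OF cm] i k by auto
  have gi: "g \<notin> X i"
    using cm i k ik g unfolding complete_matching_def disjoint_family_on_def by blast
  have Vi: "firm_value a i (Y i) = firm_value a i (X i) + a i g"
    using fin gi by (simp add: Y_def firm_value_def)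
  have Vk: "firm_value a k (Y k) = firm_value a k (X k) - a k g"
    using fin g ik by (simp add: Y_def firm_value_remove)
  have Vr: "Y r = X r" if "r \<noteq> i" "r \<noteq> k" for r using that by (simp add: Y_def)
  have nn: "0 \<le> firm_value a r (X r)" if "r \<in> {1..m}" for r
    using firm_value_nonneg[OF mk that complete_matching_subset[OF cm that]] .
  have akg: "0 \<le> a k g"
    using mk k g complete_matching_subset[OF cm k] unfolding market_def by blast
  have PY: "positive_firms m a Y = insert i ?P"
  proof -
    have "0 < firm_value a r (Y r) \<longleftrightarrow> r = i \<or> 0 < firm_value a r (X r)" if "r \<in> {1..m}" for r
      using Vi Vk Vr[of r] nn[OF i] pos rest akg ik by (cases "r = i"; cases "r = k") auto
    then show ?thesis unfolding positive_firms_def using i by auto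
  qed
  have iP: "i \<in> ?P"
  proof (rule ccontr)
    assume "i \<notin> ?P"
    then have "card (positive_firms m a Y) = Suc (card ?P)" using PY by simp
    then show False using opt cY unfolding nash_optimal_def by fastforce
  qed
  have PY: "positive_firms m a Y = ?P" using PY iP by (simp add: insert_absorb)
  then have le: "(\<Prod>r\<in>?P. firm_value a r (Y r)) \<le> (\<Prod>r\<in>?P. firm_value a r (X r))"
    using opt cY unfolding nash_optimal_def nash_product_def by auto
  have Ppos: "0 < firm_value a r (X r)" if "r \<in> ?P" for r using that by (simp add: positive_firms_def)
  \<comment> \<open>If \<open>k\<close> had value zero, the factor of \<open>i\<close> would be the
    only one to change, and it would strictly grow.\<close>
  have kP: "k \<in> ?P"
  proof (rule ccontr)
    assume nk: "k \<notin> ?P"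
    have rec: "(\<Prod>r\<in>?P. f r) = f i * (\<Prod>r\<in>?P - {i}. f r)" for f :: "nat \<Rightarrow> real"
      using iP by (simp add: prod.remove)
    have eq: "(\<Prod>r\<in>?P - {i}. firm_value a r (Y r)) = (\<Prod>r\<in>?P - {i}. firm_value a r (X r))"
    proof (rule prod.cong)
      fix r assume "r \<in> ?P - {i}"
      then have "r \<noteq> i" "r \<noteq> k" using nk by auto
      then show "firm_value a r (Y r) = firm_value a r (X r)" using Vr by simp
    qed simp
    have "0 < (\<Prod>r\<in>?P - {i}. firm_value a r (X r))" using Ppos by (intro prod_pos) auto
    then show False using le pos unfolding rec eq Vi by simp
  qed
  \<comment> \<open>The factors untouched by the move; their product is positive and can be
    cancelled.\<close>
  let ?Q = "\<Prod>r\<in>?P - {i} - {k}. firm_value a r (X r)"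
  have rec: "(\<Prod>r\<in>?P. f r) = f k * f i * (\<Prod>r\<in>?P - {i} - {k}. f r)" for f :: "nat \<Rightarrow> real"
    using iP kP ik prod.remove[of ?P i f] prod.remove[of "?P - {i}" k f] by simp
  have eq: "(\<Prod>r\<in>?P - {i} - {k}. firm_value a r (Y r)) = ?Q"
    using Vr by (intro prod.cong) auto
  have "0 < ?Q" using Ppos by (intro prod_pos) auto
  with le have "(firm_value a k (X k) - a k g) * (firm_value a i (X i) + a i g)
      \<le> firm_value a k (X k) * firm_value a i (X i)"
    unfolding rec eq Vi Vk by simp
  then show ?thesis using iP kP by blast
qed

text \<open>If \<open>g\<close> were worthless to \<open>k\<close>, giving it to \<open>i\<close>
  would cost \<open>k\<close> nothing and strictly raise the product.\<close>

lemma nash_optimal_nonwasteful: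
  assumes mk: "market m n a" and opt: "nash_optimal m n a X"
    and i: "i \<in> {1..m}" and k: "k \<in> {1..m}" and g: "g \<in> X k" and pos: "0 < a i g"
  shows "0 < a k g"
proof (rule ccontr)
  assume "\<not> 0 < a k g"
  moreover have "0 \<le> a k g"
    using mk k g complete_matching_subset[of m n X k] opt unfolding market_def nash_optimal_def by blast
  ultimately have z: "a k g = 0" by simp
  then have ik: "i \<noteq> k" using pos by auto
  from nash_optimal_move[OF mk opt i k ik g pos] z have "k \<in> positive_firms m a X"
    "firm_value a k (X k) * (firm_value a i (X i) + a i g) \<le> firm_value a k (X k) * firm_value a i (X i)"
    by auto
  then show False using pos by (simp add: positive_firms_def)
qed

text \<open>The exchange argument for maximum Nash welfare: the worker to remove is the one in
  \<open>X k\<close> with the least loss to \<open>k\<close> per unit of gain to \<open>i\<close>.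
  Its ratio is at most the average ratio over \<open>X k\<close>, and the move inequality for it
  then bounds the envy of \<open>i\<close> by \<open>a i g\<close>. This proves the case \<beta> =
  1, which implies all smaller \<beta>.\<close>

lemma nash_optimal_EF1:
  assumes mk: "market m n a" and opt: "nash_optimal m n a X" and \<beta>: "0 < \<beta>" "\<beta> \<le> 1"
  shows "EF1 m a \<beta> X"
  unfolding EF1_def
proof (intro ballI impI)
  fix i k assume i: "i \<in> {1..m}" and k: "k \<in> {1..m}" and ne: "X k \<noteq> {}"
  have cm: "complete_matching m n X" using opt by (simp add: nash_optimal_def)
  note sub = complete_matching_subset[OF cm] and fin = complete_matching_finite[OF cm]
  have nn: "0 \<le> a r j" if "r \<in> {1..m}" "s \<in> {1..m}" "j \<in> X s" for r s j
    using mk sub[OF that(2)] that unfolding market_def by blast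
  have Vn: "0 \<le> firm_value a r T" if "r \<in> {1..m}" "s \<in> {1..m}" "T \<subseteq> X s" for r s T
    using firm_value_nonneg[OF mk that(1), of T] sub[OF that(2)] that(3) by blast
  have main: "\<exists>g\<in>X k. firm_value a i (X k - {g}) \<le> firm_value a i (X i)"
  proof (cases "i = k \<or> (\<forall>j\<in>X k. a i j = 0)")
    case True
    obtain g where g: "g \<in> X k" using ne by blast
    have "firm_value a i (X k - {g}) \<le> firm_value a i (X i)"
    proof (cases "i = k")
      case True
      then show ?thesis using g firm_value_remove[OF fin[OF k] g] nn[OF i k g] by simp
    next
      case False
      with True have "firm_value a i (X k - {g}) = 0" by (simp add: firm_value_def)
      then show ?thesis using Vn[OF i i, of "X i"] by simp
    qed
    with g show ?thesis ..
  next
    case False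
    then have ik: "i \<noteq> k" by simp
    \<comment> \<open>Workers of value zero to \<open>i\<close> are left out so that the ratio
      minimized below has a positive denominator.\<close>
    define D where "D = {j \<in> X k. 0 < a i j}"
    have D: "finite D" "D \<noteq> {}"
      using fin[OF k] False nn[OF i k] by (auto simp: D_def order_less_le)
    define g where "g = arg_min_on (\<lambda>j. a k j / a i j) D"
    have gD: "g \<in> D" unfolding g_def using arg_min_if_finite(1)[OF D] .
    have gmin: "a k g / a i g \<le> a k j / a i j" if "j \<in> D" for j
      unfolding g_def by (rule arg_min_least[OF D that])
    have g: "g \<in> X k" "0 < a i g" using gD by (auto simp: D_def)
    have akg: "0 < a k g" using nash_optimal_nonwasteful[OF mk opt i k g] .
    have "a i j * a k g \<le> a k j * a i g" if j: "j \<in> X k" for j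
    proof (cases "j \<in> D")
      case True
      then show ?thesis using gmin[OF True] g(2) by (simp add: D_def field_simps)
    next
      case False
      then have "a i j = 0" using j nn[OF i k j] by (auto simp: D_def)
      then show ?thesis using nn[OF k k j] g(2) by simp
    qed
    \<comment> \<open>Summing the cross-multiplied inequalities over all of \<open>X k\<close>
      compares the minimal ratio with the ratio of the totals.\<close>
    then have ratio: "firm_value a i (X k) * a k g \<le> firm_value a k (X k) * a i g"
      unfolding firm_value_def sum_distrib_right by (rule sum_mono)
    show ?thesis
    proof (cases "a k g < firm_value a k (X k)")
      case True
      from nash_optimal_move[OF mk opt i k ik g] True
      have "(firm_value a k (X k) - a k g) * (firm_value a i (X i) + a i g)
        \<le> firm_value a k (X k) * firm_value a i (X i)" by blast
      then have "firm_value a k (X k) * a i g \<le> (firm_value a i (X i) + a i g) * a k g"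
        by (simp add: algebra_simps)
      with ratio have "firm_value a i (X k) * a k g \<le> (firm_value a i (X i) + a i g) * a k g"
        by linarith
      then have "firm_value a i (X k) \<le> firm_value a i (X i) + a i g"
        using akg by simp
      then show ?thesis by (intro bexI[OF _ g(1)]) (simp add: firm_value_remove[OF fin[OF k] g(1)])
    next
      \<comment> \<open>Here \<open>g\<close> carries the whole value of \<open>k\<close>, so the
        move would make \<open>k\<close> drop to zero and \<open>nash_optimal_move\<close> does not
        apply. The remaining workers of \<open>X k\<close> are worthless to \<open>k\<close>, hence
        by nonwastefulness also to \<open>i\<close>.\<close>
      case False
      then have "firm_value a k (X k - {g}) \<le> 0"
        using firm_value_remove[OF fin[OF k] g(1), of a k] by simp
      then have "firm_value a k (X k - {g}) = 0" using Vn[OF k k, of "X k - {g}"] by auto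
      then have z: "\<forall>j\<in>X k - {g}. a k j = 0"
        unfolding firm_value_def using nn[OF k k] fin[OF k] by (subst (asm) sum_nonneg_eq_0_iff) auto
      have "a i j = 0" if j: "j \<in> X k - {g}" for j
      proof -
        have "\<not> 0 < a i j" using nash_optimal_nonwasteful[OF mk opt i k, of j] z j by auto
        then show ?thesis using nn[OF i k, of j] j by auto
      qed
      then have "firm_value a i (X k - {g}) = 0" by (simp add: firm_value_def)
      then show ?thesis using Vn[OF i i, of "X i"] by (intro bexI[OF _ g(1)]) simp
    qed
  qed
  then obtain g where g: "g \<in> X k" "firm_value a i (X k - {g}) \<le> firm_value a i (X i)" by blast
  have "\<beta> * firm_value a i (X k - {g}) \<le> 1 * firm_value a i (X k - {g})"
    using \<beta> Vn[OF i k, of "X k - {g}"] by (intro mult_right_mono) auto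
  then show "\<exists>g\<in>X k. \<beta> * firm_value a i (X k - {g}) \<le> firm_value a i (X i)"
    using g by (intro bexI[OF _ g(1)]) linarith
qed

section \<open>The lower bound\<close>

text \<open>Both facts are needed to reason about the \<open>Max\<close> in
  \<open>frontier_value\<close>, which is unspecified on empty or infinite sets.\<close>

lemma EF1_matchings_finite_nonempty:
  assumes "market m n a" "1 \<le> m" "0 < \<beta>" "\<beta> \<le> 1"
  shows "finite {X. complete_matching m n X \<and> EF1 m a \<beta> X}"
    and "{X. complete_matching m n X \<and> EF1 m a \<beta> X} \<noteq> {}"
proof -
  show "finite {X. complete_matching m n X \<and> EF1 m a \<beta> X}"
    using finite_complete_matchings by (rule rev_finite_subset) blast
  obtain X where "nash_optimal m n a X" using nash_optimal_exists[OF assms(2)] ..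
  then show "{X. complete_matching m n X \<and> EF1 m a \<beta> X} \<noteq> {}"
    using nash_optimal_EF1[OF assms(1) _ assms(3,4)] unfolding nash_optimal_def by blast
qed

lemma nash_optimal_core_ratio:
  assumes mk: "market m n a" and opt: "nash_optimal m n a X"
    and \<delta>: "0 \<le> \<delta>" "\<delta> \<le> market_delta m n a"
  shows "ennreal \<delta> \<le> core_ratio m n a X"
proof -
  have cm: "complete_matching m n X" using opt by (simp add: nash_optimal_def)
  \<comment> \<open>The employer of \<open>j\<close>: it exists by completeness and is unique by
    disjointness.\<close>
  define f where "f j = (SOME i. i \<in> {1..m} \<and> j \<in> X i)" for j
  have f: "f j \<in> {1..m}" "j \<in> X (f j)" if "j \<in> {1..n}" for j
  proof -
    have "\<exists>i. i \<in> {1..m} \<and> j \<in> X i"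
      using cm that unfolding complete_matching_def by blast
    then have "f j \<in> {1..m} \<and> j \<in> X (f j)" unfolding f_def by (rule someI_ex)
    then show "f j \<in> {1..m}" "j \<in> X (f j)" by auto
  qed
  have f_eq: "f j = i" if "i \<in> {1..m}" "j \<in> X i" for i j
  proof -
    have "j \<in> {1..n}" using complete_matching_subset[OF cm that(1)] that(2) by blast
    from f[OF this] show ?thesis
      using cm that unfolding complete_matching_def disjoint_family_on_def by blast
  qed
  have nn: "0 \<le> a i j" if "i \<in> {1..m}" "j \<in> {1..n}" for i j
    using mk that by (simp add: market_def)
  \<comment> \<open>With zero profits the core inequality splits into one inequality per worker.
    Enlarging \<open>I\<close> to all firms only raises the maximum, and nonwastefulness makes the
    ratio at the employer one of those bounded below by \<open>market_delta\<close>.\<close>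
  have y: "\<delta> * max_value a I j \<le> a (f j) j"
    if I: "I \<subseteq> {1..m}" "I \<noteq> {}" and j: "j \<in> {1..n}" for I j
  proof (cases "\<exists>i\<in>{1..m}. 0 < a i j")
    case True
    then have "0 < a (f j) j"
      using nash_optimal_nonwasteful[OF mk opt _ f(1)[OF j] f(2)[OF j]] by blast
    then have le: "market_delta m n a * max_value a {1..m} j \<le> a (f j) j"
      using market_delta_max_value_le f(1)[OF j] j by blast
    have "0 \<le> max_value a {1..m} j"
      using max_value_ge[of "{1..m}" "f j" a j] f(1)[OF j] nn[OF f(1)[OF j] j] by force
    then have "\<delta> * max_value a {1..m} j \<le> market_delta m n a * max_value a {1..m} j"
      using \<delta>(2) by (rule mult_right_mono[rotated])
    moreover have "\<delta> * max_value a I j \<le> \<delta> * max_value a {1..m} j"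
      using \<delta>(1) I by (intro mult_left_mono max_value_mono) auto
    ultimately show ?thesis using le by linarith
  next
    \<comment> \<open>A worker worthless to every firm: the maximum is zero, so the wage zero
      suffices.\<close>
    case False
    then have "a i j = 0" if "i \<in> {1..m}" for i using nn[OF that j] that by force
    then have "(\<lambda>i. a i j) ` I = (\<lambda>_. 0) ` I" using I(1) by (intro image_cong) auto
    then have "max_value a I j = 0" using I(2) by (simp add: max_value_def image_constant_conv)
    then show ?thesis using nn[OF f(1)[OF j] j] by simp
  qed
  have "in_core m n a \<delta> X (\<lambda>_. 0) (\<lambda>j. a (f j) j)"
    unfolding in_core_def local_financing_def
  proof (intro conjI ballI allI impI)
    fix i assume "i \<in> {1..m}"
    then show "0 + (\<Sum>j\<in>X i. a (f j) j) = firm_value a i (X i)"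
      using f_eq by (simp add: firm_value_def)
  next
    fix j assume "j \<in> {1..n}"
    then show "0 \<le> a (f j) j" using nn f(1) by blast
  next
    fix I T assume "I \<subseteq> {1..m} \<and> I \<noteq> {} \<and> T \<subseteq> {1..n}"
    then have "\<delta> * (\<Sum>j\<in>T. max_value a I j) \<le> (\<Sum>j\<in>T. a (f j) j)"
      unfolding sum_distrib_left using y by (intro sum_mono) blast
    then show "\<delta> * (\<Sum>j\<in>T. max_value a I j) \<le> (\<Sum>i\<in>I. 0) + (\<Sum>j\<in>T. a (f j) j)" by simp
  qed simp
  then show ?thesis
    unfolding core_ratio_def using \<delta>(1) by (intro Sup_upper) blast
qed

lemma frontier_value_ge:
  assumes "0 < \<beta>" "\<beta> \<le> 1" "0 \<le> \<delta>"
  shows "ennreal \<delta> \<le> frontier_value \<beta> \<delta>"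
proof -
  have "ennreal \<delta> \<le> Max (core_ratio m n a ` {X. complete_matching m n X \<and> EF1 m a \<beta> X})"
    if m: "2 \<le> m" and mk: "market m n a" and d: "\<delta> \<le> market_delta m n a" for m n a
  proof -
    have m1: "1 \<le> m" using m by simp
    obtain X where X: "nash_optimal m n a X" using nash_optimal_exists[OF m1] ..
    have "X \<in> {X. complete_matching m n X \<and> EF1 m a \<beta> X}"
      using X nash_optimal_EF1[OF mk X assms(1,2)] by (simp add: nash_optimal_def)
    then have "core_ratio m n a X
        \<le> Max (core_ratio m n a ` {X. complete_matching m n X \<and> EF1 m a \<beta> X})"
      using EF1_matchings_finite_nonempty(1)[OF mk m1 assms(1,2)] by simp
    then show ?thesis
      using nash_optimal_core_ratio[OF mk X assms(3) d] by (rule order_trans[rotated])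
  qed
  then show ?thesis
    unfolding frontier_value_def by (intro INF_greatest) auto
qed

section \<open>The upper bound\<close>

text \<open>The core inequality for the grand coalition of all firms and all workers; by local
  financing, profits and wages together sum to the welfare of \<open>X\<close>.\<close>

lemma in_core_welfare:
  assumes "complete_matching m n X" "in_core m n a \<alpha> X x y" "1 \<le> m"
  shows "\<alpha> * (\<Sum>j\<in>{1..n}. max_value a {1..m} j) \<le> (\<Sum>i\<in>{1..m}. firm_value a i (X i))"
proof -
  have "\<alpha> * (\<Sum>j\<in>{1..n}. max_value a {1..m} j) \<le> (\<Sum>i\<in>{1..m}. x i) + (\<Sum>j\<in>{1..n}. y j)"
    using assms(2,3) unfolding in_core_def by simp
  also have "\<dots> = (\<Sum>i\<in>{1..m}. x i + (\<Sum>j\<in>X i. y j))"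
    by (simp only: sum_complete_matching[OF assms(1), symmetric] sum.distrib)
  also have "\<dots> = (\<Sum>i\<in>{1..m}. firm_value a i (X i))"
    using assms(2) unfolding in_core_def local_financing_def by (intro sum.cong) auto
  finally show ?thesis .
qed

text \<open>The values depend on the firm alone. The market size is supplied separately: below there
  are \<open>N\<close> workers and \<open>Suc N\<close> firms, firm 1 being the dominant
  one.\<close>

definition dominant_firm_market :: "real \<Rightarrow> nat \<Rightarrow> nat \<Rightarrow> real" where
  "dominant_firm_market \<eta> i j = (if i = 1 then 1 else \<eta>)"

lemma firm_value_dominant_firm_market:
  "firm_value (dominant_firm_market \<eta>) i T = (if i = 1 then 1 else \<eta>) * card T"
  by (simp add: firm_value_def dominant_firm_market_def)

lemma max_value_dominant_firm_market:
  assumes "1 \<le> m" "\<eta> \<le> 1"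
  shows "max_value (dominant_firm_market \<eta>) {1..m} j = 1"
  unfolding max_value_def
  by (rule Max_eqI) (use assms in \<open>auto simp: dominant_firm_market_def image_iff\<close>)

lemma market_delta_dominant_firm_market:
  assumes "1 \<le> m" "0 < \<eta>" "\<eta> \<le> 1"
  shows "\<eta> \<le> market_delta m n (dominant_firm_market \<eta>)"
proof (cases "\<exists>i\<in>{1..m}. \<exists>j\<in>{1..n}. dominant_firm_market \<eta> i j > 0")
  case True
  let ?a = "dominant_firm_market \<eta>"
  let ?R = "{?a i j / max_value ?a {1..m} j | i j. i \<in> {1..m} \<and> j \<in> {1..n} \<and> ?a i j > 0}"
  have "\<forall>r\<in>?R. \<eta> \<le> r"
    using assms
    by (auto simp: max_value_dominant_firm_market dominant_firm_market_def simp del: One_nat_def)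
  moreover have "?R \<noteq> {}" using True by blast
  ultimately have "\<eta> \<le> Min ?R"
    by (subst Min_ge_iff) (use finite_market_ratios[of ?a m n] in blast)+
  then show ?thesis using True by (simp only: market_delta_def if_True)
next
  case False
  then show ?thesis using assms by (simp only: market_delta_def if_False)
qed

lemma sum_split_first_firm:
  fixes f :: "nat \<Rightarrow> real"
  shows "(\<Sum>k\<in>{1..Suc N}. f k) = f 1 + (\<Sum>k\<in>{2..Suc N}. f k)"
  using sum.atLeast_Suc_atMost[of 1 "Suc N" f] by (simp del: sum.cl_ivl_Suc add: numeral_2_eq_2)

text \<open>Each of the other \<open>N\<close> firms must hold at least \<beta> times one less than
  the number of workers of firm 1; the positive factor \<eta> cancels. Summing over these firms and
  using that there are only \<open>N\<close> workers bounds the share of firm 1 by a quantity of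
  order \<open>1 / N\<close>.\<close>

lemma EF1_dominant_firm_card:
  fixes \<eta> \<beta> :: real
  assumes cm: "complete_matching (Suc N) N X" and ef: "EF1 (Suc N) (dominant_firm_market \<eta>) \<beta> X"
    and "0 < \<beta>" "0 < \<eta>"
  shows "(1 + N * \<beta>) * card (X 1) \<le> N * (1 + \<beta>)"
proof -
  have fin: "finite (X 1)" using complete_matching_finite[OF cm, of 1] by simp
  have "\<beta> * (real (card (X 1)) - 1) \<le> card (X k)" if k: "k \<in> {2..Suc N}" for k
  proof (cases "X 1 = {}")
    \<comment> \<open>EF1 says nothing about an empty bundle, but then the left side is
      negative.\<close>
    case True
    have "- \<beta> \<le> real (card (X k))"
      using \<open>0 < \<beta>\<close> of_nat_0_le_iff[of "card (X k)", where 'a=real] by linarith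
    with True show ?thesis by simp
  next
    case False
    then obtain g where g: "g \<in> X 1"
      "\<beta> * firm_value (dominant_firm_market \<eta>) k (X 1 - {g}) \<le> firm_value (dominant_firm_market \<eta>) k (X k)"
      using ef k unfolding EF1_def by fastforce
    have "card (X 1) \<noteq> 0" using g(1) fin by auto
    then have c: "real (card (X 1 - {g})) = real (card (X 1)) - 1"
      using g(1) fin by (simp add: of_nat_diff)
    have "\<eta> * (\<beta> * (real (card (X 1)) - 1)) \<le> \<eta> * card (X k)"
      using g(2) k unfolding firm_value_dominant_firm_market c by (simp add: mult_ac)
    then show ?thesis using \<open>0 < \<eta>\<close> by simp
  qed
  then have "(\<Sum>k\<in>{2..Suc N}. \<beta> * (real (card (X 1)) - 1)) \<le> (\<Sum>k\<in>{2..Suc N}. real (card (X k)))"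
    by (rule sum_mono)
  moreover have "real (card (X 1)) + (\<Sum>k\<in>{2..Suc N}. real (card (X k))) = N"
    using sum_complete_matching[OF cm, of "\<lambda>_. 1::real"] unfolding sum_split_first_firm by simp
  ultimately show ?thesis by (simp add: algebra_simps)
qed

text \<open>The best total is \<open>N\<close>, since each worker has maximal value 1. The welfare
  is at most \<eta> times \<open>N\<close> plus the number of workers of firm 1, so dividing by
  \<open>N\<close> and inserting the share bound gives the estimate.\<close>

lemma core_ratio_dominant_firm_market:
  fixes \<eta> \<beta> :: real
  assumes N: "1 \<le> N" and cm: "complete_matching (Suc N) N X"
    and ef: "EF1 (Suc N) (dominant_firm_market \<eta>) \<beta> X" and \<beta>: "0 < \<beta>" and \<eta>: "0 < \<eta>" "\<eta> \<le> 1"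
  shows "core_ratio (Suc N) N (dominant_firm_market \<eta>) X \<le> ennreal (\<eta> + (1 + \<beta>) / (1 + N * \<beta>))"
  unfolding core_ratio_def
proof (rule Sup_least, safe)
  fix \<alpha> :: real and x y
  assume core: "in_core (Suc N) N (dominant_firm_market \<eta>) \<alpha> X x y"
  let ?c = "\<lambda>k. real (card (X k))"
  have tot: "?c 1 + (\<Sum>k\<in>{2..Suc N}. ?c k) = N"
    using sum_complete_matching[OF cm, of "\<lambda>_. 1::real"] unfolding sum_split_first_firm by simp
  have "(\<Sum>k\<in>{2..Suc N}. firm_value (dominant_firm_market \<eta>) k (X k)) = (\<Sum>k\<in>{2..Suc N}. \<eta> * ?c k)"
    by (intro sum.cong) (auto simp: firm_value_dominant_firm_market)
  then have "(\<Sum>k\<in>{1..Suc N}. firm_value (dominant_firm_market \<eta>) k (X k))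
      = ?c 1 + \<eta> * (\<Sum>k\<in>{2..Suc N}. ?c k)"
    unfolding sum_split_first_firm sum_distrib_left by (simp add: firm_value_dominant_firm_market)
  also have "\<dots> = ?c 1 + \<eta> * (N - ?c 1)" using tot by (simp add: eq_diff_eq add.commute)
  also have "\<dots> \<le> \<eta> * N + ?c 1" using \<eta> by (simp add: algebra_simps)
  finally have "\<alpha> * N \<le> \<eta> * N + ?c 1"
    using in_core_welfare[OF cm core] max_value_dominant_firm_market[of "Suc N" \<eta>] \<eta> by simp
  moreover have "?c 1 \<le> N * ((1 + \<beta>) / (1 + N * \<beta>))"
  proof -
    have "0 < 1 + N * \<beta>" using \<beta> by (simp add: add_pos_nonneg)
    then show ?thesis
      using EF1_dominant_firm_card[OF cm ef \<beta> \<eta>(1)] by (simp add: pos_le_divide_eq mult.commute)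
  qed
  ultimately have "\<alpha> * N \<le> (\<eta> + (1 + \<beta>) / (1 + N * \<beta>)) * N"
    unfolding distrib_right mult.commute[of "(1 + \<beta>) / (1 + N * \<beta>)"] by linarith
  then have "\<alpha> \<le> \<eta> + (1 + \<beta>) / (1 + N * \<beta>)" using N by simp
  then show "ennreal \<alpha> \<le> ennreal (\<eta> + (1 + \<beta>) / (1 + N * \<beta>))" by (rule ennreal_leI)
qed

text \<open>Every \<open>N\<close> gives an admissible market, and the error term vanishes as
  \<open>N\<close> grows while \<eta> stays fixed.\<close>

lemma frontier_value_le:
  assumes \<beta>: "0 < \<beta>" "\<beta> \<le> 1" and \<eta>: "\<delta> \<le> \<eta>" "0 < \<eta>" "\<eta> \<le> 1"
  shows "frontier_value \<beta> \<delta> \<le> ennreal \<eta>"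
proof -
  let ?a = "dominant_firm_market \<eta>"
  have le: "frontier_value \<beta> \<delta> \<le> ennreal (\<eta> + (1 + \<beta>) / (1 + N * \<beta>))" if N: "1 \<le> N" for N :: nat
  proof -
    let ?S = "{X. complete_matching (Suc N) N X \<and> EF1 (Suc N) ?a \<beta> X}"
    have mk: "market (Suc N) N ?a" using \<eta> by (simp add: market_def dominant_firm_market_def)
    have d: "\<delta> \<le> market_delta (Suc N) N ?a"
      using market_delta_dominant_firm_market[of "Suc N" \<eta> N] \<eta> by simp
    have "frontier_value \<beta> \<delta> \<le> Max (core_ratio (Suc N) N ?a ` ?S)"
      unfolding frontier_value_def
      by (rule INF_lower2[of "Suc N"], use N in simp, rule INF_lower2[of "(N, ?a)"])
        (use mk d in auto)
    also have "\<dots> \<le> ennreal (\<eta> + (1 + \<beta>) / (1 + N * \<beta>))"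
    proof (rule Max.boundedI)
      show "finite (core_ratio (Suc N) N ?a ` ?S)" "core_ratio (Suc N) N ?a ` ?S \<noteq> {}"
        using EF1_matchings_finite_nonempty[OF mk _ \<beta>] by simp_all
    qed (use core_ratio_dominant_firm_market[OF N _ _ \<beta>(1) \<eta>(2,3)] in blast)
    finally show ?thesis .
  qed
  have "(\<lambda>N. \<eta> + (1 + \<beta>) / (1 + real N * \<beta>)) \<longlonglongrightarrow> \<eta> + 0"
  proof (intro tendsto_add tendsto_const real_tendsto_divide_at_top[OF tendsto_const])
    have "filterlim (\<lambda>N. real N * \<beta>) at_top sequentially"
      using \<beta>(1) by (intro filterlim_at_top_mult_tendsto_pos[OF tendsto_const] filterlim_real_sequentially)
    then show "filterlim (\<lambda>N. 1 + real N * \<beta>) at_top sequentially"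
      by (intro filterlim_tendsto_add_at_top[OF tendsto_const])
  qed
  then have "(\<lambda>N. ennreal (\<eta> + (1 + \<beta>) / (1 + real N * \<beta>))) \<longlonglongrightarrow> ennreal \<eta>"
    by (intro tendsto_ennrealI) simp
  then show ?thesis
    by (rule LIMSEQ_le_const) (use le in blast)
qed

theorem theorem10:
  fixes \<beta> \<delta> :: real
  assumes "0 < \<beta>" "\<beta> \<le> 1" "0 \<le> \<delta>" "\<delta> \<le> 1"
  shows "frontier_value \<beta> \<delta> = ennreal \<delta>"
proof (rule antisym)
  show "ennreal \<delta> \<le> frontier_value \<beta> \<delta>"
    using assms by (intro frontier_value_ge)
  show "frontier_value \<beta> \<delta> \<le> ennreal \<delta>"
  proof (rule ennreal_le_epsilon)
    fix e :: real assume e: "0 < e"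
    \<comment> \<open>Adding \<open>e\<close> keeps \<eta> positive even when \<delta> is zero; the
      cap at 1 keeps firm 1 dominant and still respects \<delta> \<le> \<eta>.\<close>
    have "frontier_value \<beta> \<delta> \<le> ennreal (min 1 (\<delta> + e))"
      using assms e by (intro frontier_value_le) auto
    also have "\<dots> \<le> ennreal (\<delta> + e)" by (intro ennreal_leI) simp
    also have "\<dots> = ennreal \<delta> + ennreal e" using assms e by simp
    finally show "frontier_value \<beta> \<delta> \<le> ennreal \<delta> + ennreal e" .
  qed
qed

end
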